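(* Let $m \ge 2$ and $n\ge 1$, and let $\mathcal{A} = (a_{i_1\cdots i_m})$ be an $m$th order $n$-dimensional completely positive tensor. If $m$ is even, then all Z-eigenvalues of $\mathcal{A}$ are nonnegative. If $m$ is odd, then every Z-eigenvector of $\mathcal{A}$ associated with a positive Z-eigenvalue is (componentwise) nonnegative, and every Z-eigenvector of $\mathcal{A}$ associated with a negative Z-eigenvalue is (componentwise) nonpositive.
   Context: A real $m$th order $n$-dimensional tensor is an array $\mathcal{A} = (a_{i_1\cdots i_m})$ of real numbers indexed by $1\le i_1,\dots,i_m\le n$. For $u\in\mathbb{R}^n$, $u^m$ denotes the rank-one tensor $(u_{i_1}\cdots u_{i_m})$. $\mathbb{R}^n_+$ is the set of nonnegative vectors in $\mathbb{R}^n$. $\mathcal{A}$ is called completely positive (CP) if there are finitely many vectors $u^{(1)},\dots,u^{(r)}\in\mathbb{R}^n_+$ with $\mathcal{A}=\sum_{k=1}^r (u^{(k)})^m$. For $x\in\mathbb{C}^n$, $\mathcal{A}x^{m-1}\in\mathbb{C}^n$ is the vector with components $(\mathcal{A}x^{m-1})_i=\sum_{i_2,\dots,i_m=1}^n a_{i i_2\cdots i_m}x_{i_2}\cdots x_{i_m}$. A number $\lambda\in\mathbb{C}$ is an E-eigenvalue of $\mathcal{A}$ with associated E-eigenvector $x\in\mathbb{C}^n$ if $\mathcal{A}x^{m-1}=\lambda x$ and $x^\top x=1$. If moreover $x$ is real (in which case $\lambda$ is real), $\lambda$ is called a Z-eigenvalue of $\mathcal{A}$ and $x$ a Z-eigenvector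 associated with $\lambda$. *)

theory Defs
  imports "HOL-Analysis.Analysis"
begin

text \<open>
  The dimension is carried by the index type \<open>'n\<close>, the order by an explicit argument \<open>m\<close>.
  A tensor of order \<open>m\<close> is a function on index lists, of which only the values on lists
  of length \<open>m\<close> matter.
\<close>

type_synonym 'n tensor = "'n list \<Rightarrow> real"

definition rank_one :: "real ^ 'n \<Rightarrow> 'n tensor"
  where "rank_one u js = (\<Prod>j\<leftarrow>js. u $ j)"

definition nonneg_vec :: "real ^ 'n \<Rightarrow> bool"
  where "nonneg_vec u \<longleftrightarrow> (\<forall>i. 0 \<le> u $ i)"

definition nonpos_vec :: "real ^ 'n \<Rightarrow> bool"
  where "nonpos_vec u \<longleftrightarrow> (\<forall>i. u $ i \<le> 0)"

definition completely_positive :: "nat \<Rightarrow> ('n::finite) tensor \<Rightarrow> bool"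
  where "completely_positive m A \<longleftrightarrow>
    (\<exists>(r::nat) (u :: nat \<Rightarrow> real ^ 'n). (\<forall>k<r. nonneg_vec (u k)) \<and>
      (\<forall>js. length js = m \<longrightarrow> A js = (\<Sum>k<r. rank_one (u k) js)))"

text \<open>The vector \<open>A x\<^sup>m\<^sup>-\<^sup>1\<close>; meaningful for \<open>m \<ge> 1\<close>.\<close>

definition tensor_apply :: "nat \<Rightarrow> ('n::finite) tensor \<Rightarrow> complex ^ 'n \<Rightarrow> complex ^ 'n"
  where "tensor_apply m A x =
    (\<chi> i. \<Sum>js | length js = m - 1. complex_of_real (A (i # js)) * (\<Prod>j\<leftarrow>js. x $ j))"

text \<open>The normalisation is \<open>x\<^sup>T x = 1\<close> without conjugation, so it is not \<open>norm x = 1\<close>.\<close>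

definition E_eigenvector :: "nat \<Rightarrow> ('n::finite) tensor \<Rightarrow> complex \<Rightarrow> complex ^ 'n \<Rightarrow> bool"
  where "E_eigenvector m A l x \<longleftrightarrow>
    tensor_apply m A x = l *s x \<and> (\<Sum>i\<in>UNIV. x $ i * x $ i) = 1"

definition complex_vec :: "real ^ 'n \<Rightarrow> complex ^ 'n"
  where "complex_vec x = (\<chi> i. complex_of_real (x $ i))"

text \<open>
  Taking the eigenvalue real loses nothing: by \<open>E_eigenvalue_real\<close> below, an E-eigenvalue
  with a real E-eigenvector is real.
\<close>

definition Z_eigenvector :: "nat \<Rightarrow> ('n::finite) tensor \<Rightarrow> real \<Rightarrow> real ^ 'n \<Rightarrow> bool"
  where "Z_eigenvector m A l x \<longleftrightarrow> E_eigenvector m A (complex_of_real l) (complex_vec x)"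

definition Z_eigenvalue :: "nat \<Rightarrow> ('n::finite) tensor \<Rightarrow> real \<Rightarrow> bool"
  where "Z_eigenvalue m A l \<longleftrightarrow> (\<exists>x. Z_eigenvector m A l x)"

lemma prod_list_of_real:
  "(\<Prod>j\<leftarrow>js. complex_of_real (f j)) = complex_of_real (\<Prod>j\<leftarrow>js. f j)"
  by (induction js) auto

lemma tensor_apply_complex_vec:
  "tensor_apply m A (complex_vec x) =
    complex_vec (\<chi> i. \<Sum>js | length js = m - 1. A (i # js) * (\<Prod>j\<leftarrow>js. x $ j))"
  by (simp add: tensor_apply_def complex_vec_def prod_list_of_real)

lemma E_eigenvalue_real:
  assumes "E_eigenvector m A l (complex_vec x)"
  shows "l \<in> \<real>"
proof -
  have ap: "tensor_apply m A (complex_vec x) = l *s complex_vec x"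
    and nz: "(\<Sum>i\<in>UNIV. complex_vec x $ i * complex_vec x $ i) = 1"
    using assms by (auto simp: E_eigenvector_def)
  have "\<exists>i. x $ i \<noteq> 0"
  proof (rule ccontr)
    assume "\<not> (\<exists>i. x $ i \<noteq> 0)"
    then show False using nz by (simp add: complex_vec_def)
  qed
  then obtain i where i: "x $ i \<noteq> 0" by blast
  define b where "b = (\<Sum>js | length js = m - 1. A (i # js) * (\<Prod>j\<leftarrow>js. x $ j))"
  have "complex_of_real b = l * complex_of_real (x $ i)"
    using arg_cong[OF ap, of "\<lambda>v. v $ i"]
    unfolding tensor_apply_complex_vec by (simp add: complex_vec_def b_def)
  then have "l = complex_of_real (b / x $ i)"
    using i by (simp add: field_simps)
  then show ?thesis by simp
qed

lemma Z_eigenvector_iff: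
  "Z_eigenvector m A l x \<longleftrightarrow>
    (\<forall>i. (\<Sum>js | length js = m - 1. A (i # js) * (\<Prod>j\<leftarrow>js. x $ j)) = l * x $ i) \<and>
    (\<Sum>i\<in>UNIV. x $ i * x $ i) = 1"
proof -
  have "tensor_apply m A (complex_vec x) = complex_of_real l *s complex_vec x \<longleftrightarrow>
    (\<forall>i. (\<Sum>js | length js = m - 1. A (i # js) * (\<Prod>j\<leftarrow>js. x $ j)) = l * x $ i)"
    unfolding tensor_apply_complex_vec
    by (simp add: complex_vec_def vec_eq_iff del: of_real_sum of_real_mult
        add: of_real_mult[symmetric])
  moreover have "(\<Sum>i\<in>UNIV. complex_vec x $ i * complex_vec x $ i) = 1 \<longleftrightarrow>
    (\<Sum>i\<in>UNIV. x $ i * x $ i) = 1"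
    by (simp add: complex_vec_def del: of_real_sum of_real_mult
        add: of_real_mult[symmetric] of_real_sum[symmetric])
  ultimately show ?thesis
    by (simp add: Z_eigenvector_def E_eigenvector_def)
qed

end

theory Submission
  imports Defs
begin

text \<open>
  For a rank-one tensor, \<open>u\<^sup>m x\<^sup>m\<^sup>-\<^sup>1 = (u \<bullet> x)\<^sup>m\<^sup>-\<^sup>1 u\<close>, so a completely positive tensor
  \<open>A = \<Sum>\<^sub>k u\<^sub>k\<^sup>m\<close> turns the Z-eigenvalue equation into
  \<open>l x = \<Sum>\<^sub>k (u\<^sub>k \<bullet> x)\<^sup>m\<^sup>-\<^sup>1 u\<^sub>k\<close> (lemma \<open>Z_eigenvector_decomposition\<close>).
  For even \<open>m\<close>, pairing with the unit vector \<open>x\<close> gives \<open>l = \<Sum>\<^sub>k (u\<^sub>k \<bullet> x)\<^sup>m\<close>, a sum of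
  even powers. For odd \<open>m\<close> the coefficients \<open>(u\<^sub>k \<bullet> x)\<^sup>m\<^sup>-\<^sup>1\<close> are themselves even powers,
  so \<open>l x\<close> is a nonnegative combination of nonnegative vectors, and the sign of \<open>l\<close> fixes
  the sign of all entries of \<open>x\<close>.
\<close>

text \<open>
  Expanding the power distributively gives one monomial for each choice of a summand from
  each factor, that is, for each index list.
\<close>

lemma sum_prod_list_eq_power:
  fixes f :: "'a::finite \<Rightarrow> 'b::comm_semiring_1"
  shows "(\<Sum>js | length js = p. \<Prod>j\<leftarrow>js. f j) = (\<Sum>i\<in>UNIV. f i) ^ p"
proof (induction p)
  case 0
  show ?case by simp
next
  case (Suc p)
  have split: "{js :: 'a list. length js = Suc p} =
      (\<lambda>(i, js). i # js) ` (UNIV \<times> {js. length js = p})"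
    by (auto simp: length_Suc_conv image_iff)
  have inj: "inj_on (\<lambda>(i :: 'a, js). i # js) (UNIV \<times> {js. length js = p})"
    by (auto simp: inj_on_def)
  have "(\<Sum>js | length js = Suc p. \<Prod>j\<leftarrow>js. f j) =
      (\<Sum>(i, js)\<in>UNIV \<times> {js. length js = p}. f i * (\<Prod>j\<leftarrow>js. f j))"
    unfolding split by (subst sum.reindex[OF inj]) (simp add: case_prod_unfold)
  also have "\<dots> = (\<Sum>i\<in>UNIV. f i) * (\<Sum>js | length js = p. \<Prod>j\<leftarrow>js. f j)"
    by (simp add: sum.cartesian_product[symmetric] sum_product)
  finally show ?case by (simp add: Suc.IH)
qed

lemma prod_list_map_mult:
  fixes f g :: "'a \<Rightarrow> 'b::comm_monoid_mult"
  shows "(\<Prod>j\<leftarrow>js. f j * g j) = (\<Prod>j\<leftarrow>js. f j) * (\<Prod>j\<leftarrow>js. g j)"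
  by (induction js) (auto simp: ac_simps)

text \<open>
  The entries of \<open>u\<^sup>p\<close> and of \<open>x\<^sup>p\<close> multiply to the monomials in the expansion of
  \<open>(\<Sum>\<^sub>j u\<^sub>j x\<^sub>j)\<^sup>p\<close>, so contracting all indices but the first leaves a multiple of \<open>u\<close>.
\<close>

lemma rank_one_apply:
  fixes u x :: "real ^ 'n"
  shows "(\<Sum>js | length js = p. rank_one u (i # js) * (\<Prod>j\<leftarrow>js. x $ j)) = u $ i * (u \<bullet> x) ^ p"
proof -
  have "(\<Sum>js | length js = p. rank_one u (i # js) * (\<Prod>j\<leftarrow>js. x $ j)) =
      u $ i * (\<Sum>js | length js = p. \<Prod>j\<leftarrow>js. u $ j * x $ j)"
    by (simp add: rank_one_def sum_distrib_left prod_list_map_mult mult.assoc)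
  then show ?thesis
    by (simp add: sum_prod_list_eq_power inner_vec_def)
qed

text \<open>
  The order is written \<open>Suc p\<close> because the eigenvalue equation contracts \<open>m - 1\<close> indices,
  which makes \<open>p\<close> the exponent that appears.
\<close>

lemma Z_eigenvector_decomposition:
  fixes A :: "('n::finite) tensor"
  assumes "completely_positive (Suc p) A"
  obtains r and u :: "nat \<Rightarrow> real ^ 'n"
    where "\<And>k i. k < r \<Longrightarrow> 0 \<le> u k $ i"
      and "\<And>l x i. Z_eigenvector (Suc p) A l x \<Longrightarrow>
        l * x $ i = (\<Sum>k<r. u k $ i * (u k \<bullet> x) ^ p)"
proof -
  obtain r and u :: "nat \<Rightarrow> real ^ 'n"
    where nonneg: "\<And>k i. k < r \<Longrightarrow> 0 \<le> u k $ i"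
      and A: "\<And>js. length js = Suc p \<Longrightarrow> A js = (\<Sum>k<r. rank_one (u k) js)"
    using assms unfolding completely_positive_def nonneg_vec_def by blast
  have "l * x $ i = (\<Sum>k<r. u k $ i * (u k \<bullet> x) ^ p)"
    if "Z_eigenvector (Suc p) A l x" for l x i
  proof -
    have "l * x $ i = (\<Sum>js | length js = p. A (i # js) * (\<Prod>j\<leftarrow>js. x $ j))"
      using that by (simp add: Z_eigenvector_iff)
    also have "\<dots> = (\<Sum>js | length js = p. \<Sum>k<r.
        rank_one (u k) (i # js) * (\<Prod>j\<leftarrow>js. x $ j))"
      by (intro sum.cong refl) (simp add: A sum_distrib_right)
    also have "\<dots> = (\<Sum>k<r. u k $ i * (u k \<bullet> x) ^ p)"
      by (subst sum.swap) (simp add: rank_one_apply)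
    finally show ?thesis .
  qed
  with nonneg show ?thesis by (rule that)
qed

lemma Z_eigenvalue_nonneg_even:
  fixes A :: "('n::finite) tensor"
  assumes cp: "completely_positive (Suc p) A" and even: "even (Suc p)"
    and ev: "Z_eigenvector (Suc p) A l x"
  shows "0 \<le> l"
proof -
  obtain r and u :: "nat \<Rightarrow> real ^ 'n"
    where eq: "\<And>i. l * x $ i = (\<Sum>k<r. u k $ i * (u k \<bullet> x) ^ p)"
    using Z_eigenvector_decomposition[OF cp] ev by metis
  have "l = (\<Sum>i\<in>UNIV. (l * x $ i) * x $ i)"
    using ev by (simp add: Z_eigenvector_iff sum_distrib_left[symmetric] mult.assoc)
  also have "\<dots> = (\<Sum>i\<in>UNIV. \<Sum>k<r. (u k $ i * x $ i) * (u k \<bullet> x) ^ p)"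
    unfolding eq sum_distrib_right by (simp add: ac_simps)
  also have "\<dots> = (\<Sum>k<r. (u k \<bullet> x) ^ Suc p)"
    by (subst sum.swap) (simp add: sum_distrib_right[symmetric] inner_vec_def)
  also have "\<dots> \<ge> 0"
    using even by (intro sum_nonneg zero_le_even_power)
  finally show ?thesis .
qed

lemma Z_eigenvector_sign_odd:
  fixes A :: "('n::finite) tensor"
  assumes cp: "completely_positive (Suc p) A" and odd: "odd (Suc p)"
    and ev: "Z_eigenvector (Suc p) A l x"
  shows "0 \<le> l * x $ i"
proof -
  obtain r and u :: "nat \<Rightarrow> real ^ 'n"
    where nonneg: "\<And>k i. k < r \<Longrightarrow> 0 \<le> u k $ i"
      and eq: "l * x $ i = (\<Sum>k<r. u k $ i * (u k \<bullet> x) ^ p)"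
    using Z_eigenvector_decomposition[OF cp] ev by metis
  show ?thesis
    unfolding eq using odd
    by (intro sum_nonneg mult_nonneg_nonneg nonneg zero_le_even_power) auto
qed

theorem theorem2:
  fixes m :: nat and A :: "('n::finite) tensor"
  assumes "m \<ge> 2" and "completely_positive m A"
  shows "(even m \<longrightarrow> (\<forall>l. Z_eigenvalue m A l \<longrightarrow> 0 \<le> l)) \<and>
    (odd m \<longrightarrow>
      (\<forall>l x. Z_eigenvector m A l x \<longrightarrow> 0 < l \<longrightarrow> nonneg_vec x) \<and>
      (\<forall>l x. Z_eigenvector m A l x \<longrightarrow> l < 0 \<longrightarrow> nonpos_vec x))"
proof -
  obtain p where m: "m = Suc p"
    using assms(1) by (cases m) auto
  have cp: "completely_positive (Suc p) A"
    using assms(2) by (simp only: m)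
  have "0 \<le> l" if "even (Suc p)" "Z_eigenvalue (Suc p) A l" for l
    using that Z_eigenvalue_nonneg_even[OF cp] unfolding Z_eigenvalue_def by blast
  moreover have "nonneg_vec x" if "odd (Suc p)" "Z_eigenvector (Suc p) A l x" "0 < l" for l x
    using Z_eigenvector_sign_odd[OF cp that(1,2)] that(3)
    by (auto simp: nonneg_vec_def zero_le_mult_iff)
  moreover have "nonpos_vec x" if "odd (Suc p)" "Z_eigenvector (Suc p) A l x" "l < 0" for l x
    using Z_eigenvector_sign_odd[OF cp that(1,2)] that(3)
    by (auto simp: nonpos_vec_def zero_le_mult_iff)
  ultimately show ?thesis
    unfolding m by blast
qed

end
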